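(* For each sequence $x\in\{a,b,c,d\}$ of optimal move counts of the parity-constrained four-peg Tower of Hanoi, $x_n=\Theta\big((\sqrt2)^n\big)$ as $n\to\infty$.
   Context: Parity-constrained four-peg Tower of Hanoi with $n$ discs labelled $1,\dots,n$ (disc $1$ smallest). Four pegs $N_1,E,O,N_2$: $N_1,N_2$ neutral, $E$ only for even-labelled discs, $O$ only for odd-labelled discs. A state places every disc on a parity-compatible peg with discs increasing from top to bottom on each peg. A legal move takes the top disc $d$ of a peg $p$ to a peg $q\ne p$ that is empty or has a larger top disc, with both $p,q$ allowed for the parity of $d$. Starting from all discs on $N_1$: $a_n$ is the minimum number of moves to bring all discs to $N_2$; $b_n$ to reach all even discs on $E$ and all odd on $O$; $c_n$ to reach all odd discs on $O$ and all even on $N_2$; $d_n$ to reach all odd discs on $N_2$ and all even on $E$. *)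

theory Defs
  imports Complex_Main "HOL-Library.Landau_Symbols"
begin

datatype peg = N1 | Ev | Od | N2

text \<open>\<open>Ev\<close> and \<open>Od\<close> are the pegs $E$ and $O$ (\<open>O\<close> is reserved syntax for relation composition). Disc \<open>d\<close> is labelled by the natural number \<open>d\<close>; smaller numbers are smaller discs.\<close>

definition allowed :: "nat \<Rightarrow> peg \<Rightarrow> bool" where
  "allowed d p \<longleftrightarrow>
     (case p of N1 \<Rightarrow> True | Ev \<Rightarrow> even d | Od \<Rightarrow> odd d | N2 \<Rightarrow> True)"

text \<open>
  Since the discs on a peg must increase from top to bottom, a state is determined by the
  peg of each disc, and the top disc of a peg is the smallest disc on it. With \<open>n\<close> discs,
  only the values of a configuration on \<open>{1..n}\<close> are meaningful.
\<close>

type_synonym config = "nat \<Rightarrow> peg"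

definition discs_on :: "nat \<Rightarrow> config \<Rightarrow> peg \<Rightarrow> nat set" where
  "discs_on n s p = {d \<in> {1..n}. s d = p}"

definition is_state :: "nat \<Rightarrow> config \<Rightarrow> bool" where
  "is_state n s \<longleftrightarrow> (\<forall>d\<in>{1..n}. allowed d (s d))"

definition top_disc :: "nat \<Rightarrow> config \<Rightarrow> peg \<Rightarrow> nat" where
  "top_disc n s p = Min (discs_on n s p)"

definition legal_move :: "nat \<Rightarrow> config \<Rightarrow> config \<Rightarrow> bool" where
  "legal_move n s s' \<longleftrightarrow> is_state n s \<and> is_state n s' \<and>
     (\<exists>d p q. discs_on n s p \<noteq> {} \<and> d = top_disc n s p \<and> q \<noteq> p \<and>
        (discs_on n s q = {} \<or> d < top_disc n s q) \<and>
        allowed d p \<and> allowed d q \<and>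
        s' = s(d := q))"

definition start :: config where
  "start = (\<lambda>d. N1)"

text \<open>
  The minimum number of moves from \<open>start\<close> to the state in which all odd discs are on peg
  \<open>p\<close> and all even discs on peg \<open>q\<close>.
\<close>

definition min_moves :: "nat \<Rightarrow> peg \<Rightarrow> peg \<Rightarrow> nat" where
  "min_moves n p q =
     (LEAST k. \<exists>t. (legal_move n ^^ k) start t \<and>
        (\<forall>d\<in>{1..n}. t d = (if odd d then p else q)))"

definition hanoi_a :: "nat \<Rightarrow> nat" where
  "hanoi_a n = min_moves n N2 N2"

definition hanoi_b :: "nat \<Rightarrow> nat" where
  "hanoi_b n = min_moves n Od Ev"

definition hanoi_c :: "nat \<Rightarrow> nat" where
  "hanoi_c n = min_moves n Od N2"

definition hanoi_d :: "nat \<Rightarrow> nat" where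
  "hanoi_d n = min_moves n N2 Ev"

end

theory Submission
  imports Defs
begin

text \<open>
  Lower bound: forgetting the odd discs turns any solution into a solution of the three-peg
  puzzle for the \<open>n div 2\<close> even discs.

  Upper bound: while one parity class is parked on its own peg, the other one can be moved between
  its three pegs at the three-peg cost. Hence to split the first \<open>m + 1\<close> discs into their own
  pegs, one splits the first \<open>m\<close> discs, clears the own peg of disc \<open>m + 1\<close> by moving its class to
  the free neutral peg, moves disc \<open>m + 1\<close>, and moves the class back. This costs $O(2^{m/2})$ on
  top of splitting \<open>m\<close> discs, so the costs form a geometric sum. From the split state, the other
  targets are reached by one more three-peg transfer; only for the target \<open>N2\<close>, \<open>N2\<close> one splits
  the first \<open>n - 1\<close> discs, moves disc \<open>n\<close>, and reverses the splitting.
\<close>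

section \<open>Legal moves described disc by disc\<close>

definition own :: "nat \<Rightarrow> peg" where
  "own d = (if even d then Ev else Od)"

lemma allowed_iff: "allowed d p \<longleftrightarrow> p = N1 \<or> p = N2 \<or> p = own d"
  by (cases p) (auto simp: allowed_def own_def)

lemma own_neq [simp]: "own d \<noteq> N1" "own d \<noteq> N2" "N1 \<noteq> own d" "N2 \<noteq> own d"
  by (auto simp: own_def)

lemma own_eq_iff [simp]: "own d = own e \<longleftrightarrow> (even d \<longleftrightarrow> even e)"
  by (auto simp: own_def)

text \<open>Minima of possibly empty sets are awkward to reason with. A disc is on top of its peg
  and fits on \<open>q\<close> exactly when no smaller disc lies on either peg; legality of the
  source peg and of the new state then follows from \<open>is_state n s\<close>.\<close>

lemma legal_move_iff:
  "legal_move n s s' \<longleftrightarrow> is_state n s \<and>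
     (\<exists>d\<in>{1..n}. \<exists>q. allowed d q \<and> q \<noteq> s d \<and> (\<forall>e\<in>{1..<d}. s e \<noteq> s d \<and> s e \<noteq> q) \<and> s' = s(d := q))"
    (is "?L \<longleftrightarrow> ?R")
proof
  assume ?L
  then obtain d p q where *: "is_state n s" "discs_on n s p \<noteq> {}" "d = top_disc n s p" "q \<noteq> p"
     "discs_on n s q = {} \<or> d < top_disc n s q" "allowed d q" "s' = s(d := q)"
    unfolding legal_move_def by blast
  have fin: "finite (discs_on n s r)" for r by (auto simp: discs_on_def)
  have "d \<in> discs_on n s p" using * fin by (simp add: top_disc_def)
  then have d: "d \<in> {1..n}" "s d = p" by (auto simp: discs_on_def)
  have "s e \<noteq> p \<and> s e \<noteq> q" if e: "e \<in> {1..<d}" for e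
  proof -
    have "e \<notin> discs_on n s p"
      using e * fin Min_le[OF fin, of e p] by (auto simp: top_disc_def)
    moreover have "e \<notin> discs_on n s q"
    proof
      assume "e \<in> discs_on n s q"
      then have "top_disc n s q \<le> e" "discs_on n s q \<noteq> {}"
        using fin by (auto simp: top_disc_def)
      with * e show False by auto
    qed
    ultimately show ?thesis using e d by (auto simp: discs_on_def)
  qed
  with d * show ?R by blast
next
  assume ?R
  then obtain d q where *: "is_state n s" "d \<in> {1..n}" "allowed d q" "q \<noteq> s d"
    "\<forall>e\<in>{1..<d}. s e \<noteq> s d \<and> s e \<noteq> q" "s' = s(d := q)" by blast
  have fin: "finite (discs_on n s r)" for r by (auto simp: discs_on_def)
  have ge: "d \<le> e" if "e \<in> discs_on n s (s d)" for e
    using that * by (metis (mono_tags, lifting) atLeastLessThan_iff atLeastAtMost_iff discs_on_def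
        mem_Collect_eq not_le)
  have gt: "d < e" if "e \<in> discs_on n s q" for e
    using that * by (metis (mono_tags, lifting) atLeastLessThan_iff atLeastAtMost_iff discs_on_def
        mem_Collect_eq not_less_iff_gr_or_eq)
  have d: "d \<in> discs_on n s (s d)" using * by (auto simp: discs_on_def)
  have "top_disc n s (s d) = d"
    unfolding top_disc_def using fin ge d by (intro Min_eqI) auto
  moreover have "discs_on n s q = {} \<or> d < top_disc n s q"
    unfolding top_disc_def using fin gt by (metis Min_in)
  moreover have "allowed d (s d)" "is_state n s'" using * by (auto simp: is_state_def)
  ultimately show ?L
    unfolding legal_move_def using * d by (metis empty_iff)
qed

lemma legal_moveI:
  assumes "is_state n s" "1 \<le> d" "d \<le> n" "allowed d q" "q \<noteq> s d"
    and "\<And>e. 1 \<le> e \<Longrightarrow> e < d \<Longrightarrow> s e \<noteq> s d \<and> s e \<noteq> q"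
  shows "legal_move n s (s(d := q))"
proof -
  have "\<forall>e\<in>{1..<d}. s e \<noteq> s d \<and> s e \<noteq> q" using assms(6) by simp
  with assms show ?thesis
    unfolding legal_move_iff by (intro conjI bexI[of _ d] exI[of _ q]) simp_all
qed

lemma legal_move_state: "legal_move n s s' \<Longrightarrow> is_state n s'"
  by (simp add: legal_move_def)

text \<open>The condition on smaller discs is symmetric in the two pegs, and these discs do not
  move. This allows a splitting to be run backwards.\<close>

lemma legal_move_sym:
  assumes "legal_move n s s'"
  shows "legal_move n s' s"
proof -
  from assms obtain d q where *: "is_state n s" "d \<in> {1..n}" "allowed d q" "q \<noteq> s d"
    "\<forall>e\<in>{1..<d}. s e \<noteq> s d \<and> s e \<noteq> q" and s': "s' = s(d := q)"
    unfolding legal_move_iff by blast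
  have "legal_move n s' (s'(d := s d))"
    by (rule legal_moveI) (use * s' in \<open>auto simp: is_state_def\<close>)
  then show ?thesis using s' by simp
qed

lemma legal_move_relpowp_sym: "(legal_move n ^^ k) s t \<Longrightarrow> (legal_move n ^^ k) t s"
proof (induction k arbitrary: t)
  case (Suc k)
  then obtain u where "(legal_move n ^^ k) s u" "legal_move n u t" by auto
  with Suc.IH show ?case by (meson legal_move_sym relpowp_Suc_I2)
qed simp

lemma legal_move_changes:
  assumes "legal_move n s s'" "s' d \<noteq> s d" "1 \<le> e" "e < d"
  shows "s e \<noteq> s d" "s e \<noteq> s' d" "s' e = s e"
  using assms by (auto simp: legal_move_iff split: if_splits)

subsection \<open>The lower bound\<close>

lemma third_peg:
  assumes "x \<noteq> y" "x \<in> {N1, N2, Ev}" "y \<in> {N1, N2, Ev}"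
  shows "\<exists>u. u \<noteq> x \<and> u \<noteq> y \<and> (\<forall>v\<in>{N1, N2, Ev}. v \<noteq> x \<longrightarrow> v \<noteq> y \<longrightarrow> v = u)"
  using assms by (elim insertE emptyE) auto

text \<open>Even discs have only three pegs. When the largest of them moves, the smaller ones are
  stacked on the third peg, so the induction hypothesis applies up to its first move and again after
  its last. The bound is stated for a segment of a run \<open>f\<close> so that it can be applied to
  subsegments; odd discs may do anything in between.\<close>

lemma even_discs_lower_bound:
  assumes "a \<le> b" "\<And>i. a \<le> i \<Longrightarrow> i < b \<Longrightarrow> legal_move n (f i) (f (Suc i))"
    and "\<And>i. a \<le> i \<Longrightarrow> i \<le> b \<Longrightarrow> is_state n (f i)"
    and "2 * k \<le> n" "p \<noteq> q"
    and "\<And>e. e \<in> {1..k} \<Longrightarrow> f a (2 * e) = p" "\<And>e. e \<in> {1..k} \<Longrightarrow> f b (2 * e) = q"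
  shows "2 ^ k \<le> Suc (b - a)"
  using assms
proof (induction k arbitrary: a b p q)
  case (Suc k)
  define m where "m = 2 * Suc k"
  have even_pegs: "f i (2 * e) \<in> {N1, N2, Ev}" if "a \<le> i" "i \<le> b" "e \<in> {1..Suc k}" for i e
  proof -
    have "allowed (2 * e) (f i (2 * e))"
      using Suc.prems(3)[of i] that Suc.prems(4) by (auto simp: is_state_def)
    then show ?thesis by (auto simp: allowed_iff own_def)
  qed
  have fa: "f a m = p" and fb: "f b m = q" using Suc.prems(6,7)[of "Suc k"] by (auto simp: m_def)
  have "a < b" using Suc.prems(1,5) fa fb by (cases "a = b") auto
  \<comment> \<open>The move from time \<open>i\<close> to \<open>Suc i\<close> is the first one by
    which disc \<open>m\<close> leaves \<open>p\<close>.\<close>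
  define Q where "Q = (\<lambda>i. a \<le> i \<and> f (Suc i) m \<noteq> p)"
  define i where "i = (LEAST i. Q i)"
  have Q: "Q (b - 1)" using \<open>a < b\<close> fb Suc.prems(5) by (auto simp: Q_def)
  have "Q i" unfolding i_def by (rule LeastI[where P = Q, OF Q])
  then have i1: "a \<le> i" "f (Suc i) m \<noteq> p" by (auto simp: Q_def)
  have "i \<le> b - 1" unfolding i_def by (rule Least_le[where P = Q, OF Q])
  then have ib: "i < b" using \<open>a < b\<close> by linarith
  have before: "f l m = p" if "a \<le> l" "l \<le> i" for l
  proof (cases "l = a")
    case False
    then have "\<not> Q (l - 1)"
      using that unfolding i_def by (intro not_less_Least) auto
    then show ?thesis using that False by (auto simp: Q_def)
  qed (use fa in auto)
  \<comment> \<open>The move from time \<open>j\<close> to \<open>Suc j\<close> is the last arrival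
    of disc \<open>m\<close> on \<open>q\<close>. It may coincide with the first departure, so only
    \<open>i \<le> j\<close> holds.\<close>
  define P where "P = (\<lambda>j. j < b \<and> f j m \<noteq> q)"
  define j where "j = (GREATEST j. P j)"
  have Pi: "P i" using before[of i] i1 ib Suc.prems(5) by (auto simp: P_def)
  have bnd: "\<And>y. P y \<Longrightarrow> y \<le> b" by (auto simp: P_def)
  have "P j" unfolding j_def by (rule GreatestI_nat[where P = P, OF Pi bnd])
  then have j1: "j < b" "f j m \<noteq> q" by (auto simp: P_def)
  have ij: "i \<le> j" unfolding j_def by (rule Greatest_le_nat[where P = P, OF Pi bnd])
  have j2: "f (Suc j) m = q"
  proof (rule ccontr)
    assume neq: "f (Suc j) m \<noteq> q"
    then have "Suc j \<noteq> b" using fb by auto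
    then have "P (Suc j)" using neq j1 by (auto simp: P_def)
    then have "Suc j \<le> j" unfolding j_def by (rule Greatest_le_nat[where P = P, OF _ bnd])
    then show False by simp
  qed
  have third: "\<exists>u. u \<noteq> f l m \<and> u \<noteq> f (Suc l) m \<and>
      (\<forall>e\<in>{1..k}. f l (2 * e) = u \<and> f (Suc l) (2 * e) = u)"
    if l: "a \<le> l" "l < b" "f (Suc l) m \<noteq> f l m" for l
  proof -
    have move: "legal_move n (f l) (f (Suc l))" using Suc.prems(2) l by auto
    have m_pegs: "f l m \<in> {N1, N2, Ev}" "f (Suc l) m \<in> {N1, N2, Ev}"
      using even_pegs[of l "Suc k"] even_pegs[of "Suc l" "Suc k"] l by (auto simp: m_def)
    obtain u where u: "u \<noteq> f l m" "u \<noteq> f (Suc l) m"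
      "\<And>v. v \<in> {N1, N2, Ev} \<Longrightarrow> v \<noteq> f l m \<Longrightarrow> v \<noteq> f (Suc l) m \<Longrightarrow> v = u"
      using third_peg[OF l(3)[symmetric] m_pegs] by blast
    have "f l (2 * e) = u \<and> f (Suc l) (2 * e) = u" if e: "e \<in> {1..k}" for e
      using legal_move_changes[OF move l(3), of "2 * e"] e even_pegs[of l e] l u(3)
      by (auto simp: m_def)
    then show ?thesis using u(1,2) by blast
  qed
  have "f (Suc i) m \<noteq> f i m" using i1 before[of i] by auto
  then obtain u where u: "u \<noteq> f i m" "\<forall>e\<in>{1..k}. f i (2 * e) = u"
    using third[of i] i1 ib by blast
  have "2 ^ k \<le> Suc (i - a)"
    by (rule Suc.IH[of a i p u]) (use Suc.prems u i1 ib before[of i] in auto)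
  moreover have "f (Suc j) m \<noteq> f j m" using j1 j2 by auto
  then obtain v where v: "v \<noteq> f (Suc j) m" "\<forall>e\<in>{1..k}. f (Suc j) (2 * e) = v"
    using third[of j] i1 j1 ij by (metis order_trans)
  have "2 ^ k \<le> Suc (b - Suc j)"
    by (rule Suc.IH[of "Suc j" b v q]) (use Suc.prems v i1 ij j1 j2 in auto)
  \<comment> \<open>\<open>Suc (b - a)\<close> counts the states of the segment. The segments from
    \<open>a\<close> to \<open>i\<close> and from \<open>Suc j\<close> to \<open>b\<close> are
    disjoint, so their counts add up without correction.\<close>
  ultimately have "2 ^ k + 2 ^ k \<le> Suc (i - a) + Suc (b - Suc j)" by linarith
  also have "\<dots> \<le> Suc (b - a)" using i1 ij j1 by linarith
  finally show ?case by simp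
qed simp

text \<open>All four targets take the even discs away from \<open>N1\<close>, so one bound serves
  them all; the peg of the odd discs is irrelevant.\<close>

lemma lower_bound:
  assumes "(legal_move n ^^ k) start t" "\<forall>d\<in>{1..n}. t d = (if odd d then p else q)" "q \<noteq> N1"
  shows "2 ^ (n div 2) \<le> Suc k"
proof -
  obtain f where f: "f 0 = start" "f k = t" "\<And>i. i < k \<Longrightarrow> legal_move n (f i) (f (Suc i))"
    using assms(1) unfolding relpowp_fun_conv by blast
  have "is_state n (f i)" if "i \<le> k" for i
  proof (cases i)
    case 0
    then show ?thesis using f by (auto simp: is_state_def start_def allowed_iff)
  next
    case (Suc j)
    then show ?thesis using f(3)[of j] that by (auto simp: legal_move_def)
  qed
  then have "2 ^ (n div 2) \<le> Suc (k - 0)"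
    by (intro even_discs_lower_bound[where f = f and p = N1 and q = q and n = n])
      (use f assms in \<open>auto simp: start_def\<close>)
  then show ?thesis by simp
qed

subsection \<open>The upper bound\<close>

lemma third_allowed_peg: "\<exists>u. allowed d u \<and> u \<noteq> p \<and> u \<noteq> q"
proof -
  have "N1 \<noteq> N2" by simp
  then have "N1 \<noteq> p \<and> N1 \<noteq> q \<or> N2 \<noteq> p \<and> N2 \<noteq> q \<or> own d \<noteq> p \<and> own d \<noteq> q"
    by (metis own_neq(3,4))
  then show ?thesis by (auto simp: allowed_iff)
qed

text \<open>This is the three-peg recursion for the discs of parity \<open>r\<close>, of which there
  are \<open>(m + r) div 2\<close> among the first \<open>m\<close>. Here \<open>r\<close> also
  serves as a label representing its class in \<open>allowed r p\<close>. Discs above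
  \<open>m\<close> are unconstrained, since larger discs never block a move.\<close>

lemma class_transfer:
  assumes "is_state n s" "m \<le> n" "r < 2" "allowed r p" "allowed r q" "p \<noteq> q"
    and "\<And>d. 1 \<le> d \<Longrightarrow> d \<le> m \<Longrightarrow> s d = (if d mod 2 = r then p else own d)"
  shows "(legal_move n ^^ (2 ^ ((m + r) div 2) - 1)) s
     (\<lambda>d. if 1 \<le> d \<and> d \<le> m \<and> d mod 2 = r then q else s d)"
  using assms
proof (induction m arbitrary: s p q)
  case 0
  then have "r div 2 = 0" "(\<lambda>d. if 1 \<le> d \<and> d \<le> 0 \<and> d mod 2 = r then q else s d) = s" by auto
  then show ?case by simp
next
  case (Suc m)
  let ?t = "\<lambda>u d. if 1 \<le> d \<and> d \<le> m \<and> d mod 2 = r then u else s d"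
  show ?case
  proof (cases "Suc m mod 2 = r")
    case False
    then have "(Suc m + r) div 2 = (m + r) div 2" using \<open>r < 2\<close> by presburger
    moreover have "(\<lambda>d. if 1 \<le> d \<and> d \<le> Suc m \<and> d mod 2 = r then q else s d) = ?t q"
      using False by (auto simp: le_Suc_eq)
    moreover have "(legal_move n ^^ (2 ^ ((m + r) div 2) - 1)) s (?t q)"
      by (rule Suc.IH[of s p q]) (use Suc.prems in auto)
    ultimately show ?thesis by simp
  next
    case True
    have exp: "(Suc m + r) div 2 = Suc ((m + r) div 2)" using \<open>r < 2\<close> True by presburger
    obtain u where u: "allowed r u" "u \<noteq> p" "u \<noteq> q"
      using third_allowed_peg by blast
    have allowed_class: "allowed d u" "allowed d q" if "d mod 2 = r" for d
      using that u(1) Suc.prems(5) by (auto simp: allowed_iff own_def)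
    have 1: "(legal_move n ^^ (2 ^ ((m + r) div 2) - 1)) s (?t u)"
      by (rule Suc.IH[of s p u]) (use Suc.prems u in auto)
    have st: "is_state n (?t u)"
      using Suc.prems(1) allowed_class by (auto simp: is_state_def)
    have sm: "s (Suc m) = p" using Suc.prems True by auto
    have 2: "legal_move n (?t u) ((?t u)(Suc m := q))"
    proof (rule legal_moveI[OF st])
      fix e assume e: "1 \<le> e" "e < Suc m"
      show "?t u e \<noteq> ?t u (Suc m) \<and> ?t u e \<noteq> q"
      proof (cases "e mod 2 = r")
        case False
        \<comment> \<open>A disc of the other class rests on a peg forbidden to class
          \<open>r\<close>, hence on neither \<open>p\<close> nor \<open>q\<close>.\<close>
        then have "own e \<noteq> own r" using \<open>r < 2\<close> by (auto simp: own_def) presburger+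
        then have "own e \<noteq> p" "own e \<noteq> q" using Suc.prems(4,5) by (auto simp: allowed_iff)
        then show ?thesis using e Suc.prems(7)[of e] False sm by auto
      qed (use e u sm in auto)
    qed (use Suc.prems(2,6) sm allowed_class(2)[OF True] in auto)
    let ?w = "(?t u)(Suc m := q)"
    have 3: "(legal_move n ^^ (2 ^ ((m + r) div 2) - 1)) ?w
        (\<lambda>d. if 1 \<le> d \<and> d \<le> m \<and> d mod 2 = r then q else ?w d)"
    proof (rule Suc.IH[of ?w u q, OF legal_move_state[OF 2]])
      show "?w d = (if d mod 2 = r then u else own d)" if "1 \<le> d" "d \<le> m" for d
        using that Suc.prems(7)[of d] by simp
    qed (use Suc.prems(2-5) u in simp_all)
    have 4: "(\<lambda>d. if 1 \<le> d \<and> d \<le> m \<and> d mod 2 = r then q else ?w d) =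
       (\<lambda>d. if 1 \<le> d \<and> d \<le> Suc m \<and> d mod 2 = r then q else s d)"
      using True by (auto simp: fun_eq_iff le_Suc_eq)
    have "(legal_move n ^^ (2 ^ ((m + r) div 2) - 1 + (1 + (2 ^ ((m + r) div 2) - 1)))) s
       (\<lambda>d. if 1 \<le> d \<and> d \<le> Suc m \<and> d mod 2 = r then q else s d)"
      using 1 2 3 unfolding 4 relpowp_add by (auto simp: OO_def)
    moreover have "2 ^ ((m + r) div 2) - 1 + (1 + (2 ^ ((m + r) div 2) - 1)) =
        2 ^ ((Suc m + r) div 2) - (1::nat)"
      unfolding exp by (simp add: mult_2)
    ultimately show ?thesis by metis
  qed
qed

text \<open>A closed form with increments \<open>2 * 2 ^ (m div 2)\<close>. The true cost of adding
  one disc to the splitting below is one less: two transfers of \<open>2 ^ (m div 2) - 1\<close>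
  moves and a single move.\<close>

definition split_bound :: "nat \<Rightarrow> nat" where
  "split_bound m = 2 * (2 ^ ((m + 1) div 2) + 2 ^ (m div 2))"

lemma split_bound_Suc: "split_bound (Suc m) = split_bound m + 2 * 2 ^ (m div 2)"
  by (simp add: split_bound_def)

lemma split_discs:
  assumes "is_state n s" "m \<le> n" "p \<in> {N1, N2}" "\<And>d. 1 \<le> d \<Longrightarrow> d \<le> m \<Longrightarrow> s d = p"
  shows "\<exists>k \<le> split_bound m. (legal_move n ^^ k) s (\<lambda>d. if 1 \<le> d \<and> d \<le> m then own d else s d)"
  using assms
proof (induction m arbitrary: s)
  case 0
  have "(\<lambda>d. if 1 \<le> d \<and> d \<le> 0 then own d else s d) = s" by auto
  then show ?case by (auto intro!: exI[of _ 0])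
next
  case (Suc m)
  let ?s1 = "\<lambda>d. if 1 \<le> d \<and> d \<le> m then own d else s d"
  obtain k where k: "k \<le> split_bound m" "(legal_move n ^^ k) s ?s1"
    using Suc.IH[of s] Suc.prems by auto
  define r where "r = Suc m mod 2"
  have r: "r < 2" by (simp add: r_def)
  define c where "c = own (Suc m)"
  have own_r: "own d = c \<longleftrightarrow> d mod 2 = r" for d
    unfolding c_def r_def own_eq_iff by presburger
  have c: "c \<noteq> N1" "c \<noteq> N2" "allowed r c" by (auto simp: c_def r_def allowed_iff)
  define q where "q = (if p = N1 then N2 else N1)"
  have q: "q \<in> {N1, N2}" "q \<noteq> p" using Suc.prems(3) by (auto simp: q_def)
  \<comment> \<open>Among the first \<open>m\<close> discs, \<open>m div 2\<close> have the parity
    of disc \<open>m + 1\<close>.\<close>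
  have exp: "(m + r) div 2 = m div 2" unfolding r_def by presburger
  let ?c = "2 ^ (m div 2) - (1::nat)"
  let ?s2 = "\<lambda>d. if 1 \<le> d \<and> d \<le> m \<and> d mod 2 = r then q else ?s1 d"
  have st1: "is_state n ?s1" using Suc.prems(1) by (auto simp: is_state_def allowed_iff)
  have 2: "(legal_move n ^^ ?c) ?s1 ?s2"
    unfolding exp[symmetric]
  proof (rule class_transfer[of n ?s1 m r c q, OF st1])
    show "?s1 d = (if d mod 2 = r then c else own d)" if "1 \<le> d" "d \<le> m" for d
      using that own_r[of d] by auto
    show "allowed r q" "c \<noteq> q" using q c by (auto simp: allowed_iff)
  qed (use Suc.prems(2) r c in simp_all)
  have st2: "is_state n ?s2" using st1 q by (auto simp: is_state_def allowed_iff)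
  let ?s3 = "?s2(Suc m := c)"
  have 3: "legal_move n ?s2 ?s3"
  proof (rule legal_moveI[OF st2])
    fix e assume "1 \<le> e" "e < Suc m"
    \<comment> \<open>Smaller discs now lie on \<open>q\<close> or on the own peg of the other
      class, so \<open>p\<close> and \<open>c\<close> are free of them.\<close>
    then show "?s2 e \<noteq> ?s2 (Suc m) \<and> ?s2 e \<noteq> c"
      using q Suc.prems(3) Suc.prems(4)[of "Suc m"] c own_r[of e] by auto
  qed (use Suc.prems(2,3) Suc.prems(4)[of "Suc m"] c in \<open>auto simp: allowed_iff c_def\<close>)
  let ?s4 = "\<lambda>d. if 1 \<le> d \<and> d \<le> m \<and> d mod 2 = r then c else ?s3 d"
  have 4: "(legal_move n ^^ ?c) ?s3 ?s4"
    unfolding exp[symmetric]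
  proof (rule class_transfer[of n ?s3 m r q c, OF legal_move_state[OF 3]])
    show "?s3 d = (if d mod 2 = r then q else own d)" if "1 \<le> d" "d \<le> m" for d
      using that by simp
    show "allowed r q" "q \<noteq> c" using q c by (auto simp: allowed_iff)
  qed (use Suc.prems(2) r c in simp_all)
  have eq: "?s4 = (\<lambda>d. if 1 \<le> d \<and> d \<le> Suc m then own d else s d)"
  proof
    fix d
    show "?s4 d = (if 1 \<le> d \<and> d \<le> Suc m then own d else s d)"
    proof (cases "d = Suc m")
      case True
      then show ?thesis by (simp add: c_def)
    next
      case False
      then show ?thesis using own_r[of d] by auto
    qed
  qed
  have path: "(legal_move n ^^ (k + (?c + (1 + ?c)))) s ?s4"
    using k(2) 2 3 4 unfolding relpowp_add by (auto simp: OO_def)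
  have "k + (?c + (1 + ?c)) \<le> split_bound (Suc m)"
    using k(1) unfolding split_bound_Suc by simp
  with path show ?case unfolding eq by blast
qed

lemma is_state_start: "is_state n start"
  by (auto simp: is_state_def start_def allowed_iff)

lemma reach_split:
  "\<exists>k \<le> split_bound n. (legal_move n ^^ k) start (\<lambda>d. if 1 \<le> d \<and> d \<le> n then own d else start d)"
  using split_discs[of n start n N1] is_state_start by (simp add: start_def[THEN fun_cong])

text \<open>The case \<open>r = 0\<close> yields the target of \<open>hanoi_c\<close>, and
  \<open>r = 1\<close> that of \<open>hanoi_d\<close>. The final transfer costs at most another
  \<open>split_bound n\<close>.\<close>

lemma reach_split_transfer:
  assumes "r < 2" "q \<in> {N1, N2}"
  shows "\<exists>k t. k \<le> 2 * split_bound n \<and> (legal_move n ^^ k) start t \<and>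
     (\<forall>d\<in>{1..n}. t d = (if d mod 2 = r then q else own d))"
proof -
  let ?s = "\<lambda>d. if 1 \<le> d \<and> d \<le> n then own d else start d"
  obtain k where k: "k \<le> split_bound n" "(legal_move n ^^ k) start ?s"
    using reach_split by blast
  let ?c = "2 ^ ((n + r) div 2) - (1::nat)"
  let ?t = "\<lambda>d. if 1 \<le> d \<and> d \<le> n \<and> d mod 2 = r then q else ?s d"
  have "(legal_move n ^^ ?c) ?s ?t"
  proof (rule class_transfer[of n ?s n r "own r" q])
    show "?s d = (if d mod 2 = r then own r else own d)" if "1 \<le> d" "d \<le> n" for d
      using that by (auto simp: own_def intro: odd_pos)
    show "is_state n ?s" by (auto simp: is_state_def allowed_iff)
    show "allowed r (own r)" "allowed r q" "own r \<noteq> q" using assms by (auto simp: allowed_iff)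
  qed (use assms in simp_all)
  then have path: "(legal_move n ^^ (k + ?c)) start ?t"
    using k(2) unfolding relpowp_add by (auto simp: OO_def)
  have "(2::nat) ^ ((n + r) div 2) \<le> 2 ^ ((n + 1) div 2)"
    using assms(1) by (intro power_increasing div_le_mono) auto
  then have "?c \<le> 2 ^ ((n + 1) div 2)" by (meson diff_le_self le_trans)
  also have "\<dots> \<le> split_bound n" by (simp add: split_bound_def)
  finally have "k + ?c \<le> 2 * split_bound n" using k(1) by linarith
  with path show ?thesis by (intro exI[of _ "k + ?c"] exI[of _ ?t]) auto
qed

lemma reach_N2:
  "\<exists>k t. k \<le> 2 * split_bound n \<and> (legal_move n ^^ k) start t \<and> (\<forall>d\<in>{1..n}. t d = N2)"
proof (cases n)
  case 0
  then show ?thesis by (auto intro!: exI[of _ 0])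
next
  case (Suc m)
  let ?s = "\<lambda>d. if 1 \<le> d \<and> d \<le> m then own d else start d"
  obtain k where k: "k \<le> split_bound m" "(legal_move n ^^ k) start ?s"
    using split_discs[of n start m N1] is_state_start Suc by (auto simp: start_def[THEN fun_cong])
  have 2: "legal_move n ?s (?s(n := N2))"
    by (rule legal_moveI) (use Suc in \<open>auto simp: is_state_def start_def allowed_iff\<close>)
  \<comment> \<open>Outside \<open>{1..n}\<close> this agrees with \<open>start\<close>, so that the
    two halves of the path meet in the same function and not merely in the same state.\<close>
  let ?t = "\<lambda>d. if 1 \<le> d \<and> d \<le> n then N2 else start d"
  obtain l where l: "l \<le> split_bound m"
    "(legal_move n ^^ l) ?t (\<lambda>d. if 1 \<le> d \<and> d \<le> m then own d else ?t d)"
    using split_discs[of n ?t m N2] Suc by (auto simp: start_def is_state_def allowed_iff)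
  have "(\<lambda>d. if 1 \<le> d \<and> d \<le> m then own d else ?t d) = ?s(n := N2)"
    using Suc by (auto simp: fun_eq_iff le_Suc_eq)
  then have "(legal_move n ^^ l) (?s(n := N2)) ?t"
    using legal_move_relpowp_sym[OF l(2)] by simp
  then have "(legal_move n ^^ (k + (1 + l))) start ?t"
    using k(2) 2 unfolding relpowp_add by (auto simp: OO_def)
  \<comment> \<open>Strictness pays for the single move of disc \<open>n\<close>.\<close>
  moreover have "split_bound m < split_bound (Suc m)" by (simp add: split_bound_Suc)
  then have "k + (1 + l) \<le> 2 * split_bound n"
    using k(1) l(1) unfolding Suc by linarith
  ultimately show ?thesis by (intro exI[of _ "k + (1 + l)"] exI[of _ ?t]) auto
qed

subsection \<open>Asymptotics\<close>

text \<open>One explicit path does double duty: it bounds the minimum, and it shows that the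
  \<open>LEAST\<close> is attained, without which \<open>lower_bound\<close> could not be applied to
  it.\<close>

lemma min_moves_bounds:
  assumes "k \<le> B" "(legal_move n ^^ k) start t" "\<forall>d\<in>{1..n}. t d = (if odd d then p else q)"
    and "q \<noteq> N1"
  shows "min_moves n p q \<le> B" "2 ^ (n div 2) \<le> Suc (min_moves n p q)"
proof -
  let ?P = "\<lambda>k. \<exists>t. (legal_move n ^^ k) start t \<and> (\<forall>d\<in>{1..n}. t d = (if odd d then p else q))"
  have P: "?P k" using assms by blast
  show "min_moves n p q \<le> B"
    unfolding min_moves_def using Least_le[of ?P, OF P] assms(1) by linarith
  show "2 ^ (n div 2) \<le> Suc (min_moves n p q)"
    unfolding min_moves_def using LeastI[of ?P, OF P] lower_bound assms(4) by blast
qed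

lemma hanoi_bounds:
  assumes "x \<in> {hanoi_a, hanoi_b, hanoi_c, hanoi_d}"
  shows "x n \<le> 2 * split_bound n \<and> 2 ^ (n div 2) \<le> Suc (x n)"
proof -
  have "hanoi_a n \<le> 2 * split_bound n \<and> 2 ^ (n div 2) \<le> Suc (hanoi_a n)"
    using reach_N2[of n] min_moves_bounds[of _ _ n _ N2 N2] unfolding hanoi_a_def by auto
  moreover have "hanoi_b n \<le> 2 * split_bound n \<and> 2 ^ (n div 2) \<le> Suc (hanoi_b n)"
  proof -
    obtain k where k: "k \<le> split_bound n"
      "(legal_move n ^^ k) start (\<lambda>d. if 1 \<le> d \<and> d \<le> n then own d else start d)"
      using reach_split by blast
    then show ?thesis
      using min_moves_bounds[OF _ k(2), of "2 * split_bound n" Od Ev]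
      unfolding hanoi_b_def by (auto simp: own_def)
  qed
  moreover have "hanoi_c n \<le> 2 * split_bound n \<and> 2 ^ (n div 2) \<le> Suc (hanoi_c n)"
  proof -
    obtain k t where k: "k \<le> 2 * split_bound n" "(legal_move n ^^ k) start t"
      "\<forall>d\<in>{1..n}. t d = (if d mod 2 = 0 then N2 else own d)"
      using reach_split_transfer[of 0 N2 n] by auto
    have "\<forall>d\<in>{1..n}. t d = (if odd d then Od else N2)" using k(3) by (auto simp: own_def)
    from min_moves_bounds[OF k(1,2) this] show ?thesis unfolding hanoi_c_def by auto
  qed
  moreover have "hanoi_d n \<le> 2 * split_bound n \<and> 2 ^ (n div 2) \<le> Suc (hanoi_d n)"
  proof -
    obtain k t where k: "k \<le> 2 * split_bound n" "(legal_move n ^^ k) start t"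
      "\<forall>d\<in>{1..n}. t d = (if d mod 2 = 1 then N2 else own d)"
      using reach_split_transfer[of 1 N2 n] by auto
    have "\<forall>d\<in>{1..n}. t d = (if odd d then N2 else Ev)"
      using k(3) by (auto simp: own_def odd_iff_mod_2_eq_one)
    from min_moves_bounds[OF k(1,2) this] show ?thesis unfolding hanoi_d_def by auto
  qed
  ultimately show ?thesis using assms by auto
qed

lemma two_power_eq_sqrt: "(2::real) ^ k = sqrt 2 ^ (2 * k)"
  by (simp add: power_mult)

lemma split_bound_le: "real (split_bound n) \<le> 8 * sqrt 2 ^ n"
proof -
  have "(2::real) ^ ((n + 1) div 2) \<le> sqrt 2 ^ (n + 1)"
    unfolding two_power_eq_sqrt by (rule power_increasing) auto
  also have "\<dots> \<le> 2 * sqrt 2 ^ n"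
    using sqrt2_less_2 by (simp add: mult_right_mono)
  finally have "(2::real) ^ ((n + 1) div 2) \<le> 2 * sqrt 2 ^ n" .
  moreover have "(2::real) ^ (n div 2) \<le> sqrt 2 ^ n"
    unfolding two_power_eq_sqrt by (rule power_increasing) auto
  \<comment> \<open>The estimates give the constant \<open>2 * (2 + 1) = 6\<close>; nonnegativity
    permits rounding it up to 8.\<close>
  moreover have "0 \<le> sqrt 2 ^ n" by simp
  moreover have "real (split_bound n) = 2 * (2 ^ ((n + 1) div 2) + 2 ^ (n div 2))"
    by (simp add: split_bound_def)
  ultimately show ?thesis by argo
qed

theorem theorem5p5:
  fixes x :: "nat \<Rightarrow> nat"
  assumes "x \<in> {hanoi_a, hanoi_b, hanoi_c, hanoi_d}"
  shows "(\<lambda>n. real (x n)) \<in> \<Theta>(\<lambda>n. sqrt 2 ^ n)"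
proof (rule bigthetaI)
  have "real (x n) \<le> 16 * sqrt 2 ^ n" for n
    using hanoi_bounds[OF assms, of n] split_bound_le[of n] by linarith
  then show "(\<lambda>n. real (x n)) \<in> O(\<lambda>n. sqrt 2 ^ n)"
    by (intro bigoI[of _ 16] always_eventually) simp
  \<comment> \<open>Let \<open>P = 2 ^ (n div 2)\<close>. For \<open>n \<ge> 2\<close> we get
    \<open>P \<ge> 2\<close>, so \<open>x n \<ge> P - 1 \<ge> P / 2\<close>, while
    \<open>sqrt 2 ^ n \<le> 2 * P\<close>; together these give the factor 1/4.\<close>
  have lower: "1 / 4 * sqrt 2 ^ n \<le> real (x n)" if n: "n \<ge> 2" for n
  proof -
    have "sqrt 2 ^ n \<le> sqrt 2 ^ Suc (2 * (n div 2))"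
      by (rule power_increasing) auto
    also have "\<dots> = sqrt 2 * 2 ^ (n div 2)" by (simp add: two_power_eq_sqrt)
    also have "\<dots> \<le> 2 * 2 ^ (n div 2)" using sqrt2_less_2 by (intro mult_right_mono) auto
    finally have "sqrt 2 ^ n \<le> 2 * 2 ^ (n div 2)" .
    moreover have "(2::real) ^ (n div 2) \<ge> 2 ^ 1"
      using n by (intro power_increasing) auto
    moreover have "real (2 ^ (n div 2)) \<le> real (Suc (x n))"
      using hanoi_bounds[OF assms, of n] of_nat_le_iff by blast
    ultimately show ?thesis by simp
  qed
  show "(\<lambda>n. real (x n)) \<in> \<Omega>(\<lambda>n. sqrt 2 ^ n)"
    by (intro landau_omega.bigI[of "1 / 4"] eventually_mono[OF eventually_ge_at_top[of 2]])
      (use lower in simp_all)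
qed

end
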